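(* There exists a real Banach space $X$ with the relative Daugavet property that contains no Daugavet-point.
   Context: All Banach spaces are real. $B_X$ and $S_X$ denote the closed unit ball and unit sphere of $X$. A slice of $B_X$ is a set of the form $S(x^*,\alpha)=\{y\in B_X:\ x^*(y)>\sup x^*(B_X)-\alpha\}$ with $x^*\in X^*$ and $\alpha>0$. For $x\in S_X$ let $D(x)=\{x^*\in S_{X^*}:\ x^*(x)=1\}$; a supporting slice at $x$ is a slice $S(x^*,\alpha)$ with $x^*\in D(x)$ and $\alpha>0$. A point $x\in S_X$ is a Daugavet-point if $\sup_{y\in T}\|x-y\|=2$ for every slice $T$ of $B_X$. It is a Daugavet-point relative to a supporting slice $S$ at $x$ if $\sup_{y\in T}\|x-y\|=2$ for every slice $T$ of $B_X$ with $T\subseteq S$, and a relative Daugavet-point if it is a Daugavet-point relative to some supporting slice at $x$. $X$ (with $X\neq\{0\}$) has the relative Daugavet property if every point of $S_X$ is a relative Daugavet-point. *)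

theory Defs
  imports "HOL-Analysis.Analysis"
begin

(* A Banach space whose existence is asserted cannot be a type, so it is given by a carrier X,
   a linear subspace of some real vector space type, together with a norm N on X.  Only the linear
   structure of the ambient type is used: N is unrelated to any norm or topology of that type,
   and the values of N outside X are irrelevant. *)

locale normed_space_on =
  fixes X :: "'a::real_vector set" and N :: "'a \<Rightarrow> real"
  assumes subspace: "subspace X"
    and nonneg: "x \<in> X \<Longrightarrow> 0 \<le> N x"
    and zero_iff: "x \<in> X \<Longrightarrow> N x = 0 \<longleftrightarrow> x = 0"
    and homogeneous: "x \<in> X \<Longrightarrow> N (c *\<^sub>R x) = \<bar>c\<bar> * N x"
    and triangle: "x \<in> X \<Longrightarrow> y \<in> X \<Longrightarrow> N (x + y) \<le> N x + N y"

locale banach_space_on = normed_space_on +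
  assumes complete:
    "\<lbrakk>\<And>n. \<sigma> n \<in> X; \<And>e. e > 0 \<Longrightarrow> \<exists>M::nat. \<forall>m\<ge>M. \<forall>n\<ge>M. N (\<sigma> m - \<sigma> n) < e\<rbrakk>
      \<Longrightarrow> \<exists>l\<in>X. (\<lambda>n. N (\<sigma> n - l)) \<longlonglongrightarrow> 0"

context
  fixes X :: "'a::real_vector set" and N :: "'a \<Rightarrow> real"
begin

definition unit_ball :: "'a set" where
  "unit_ball = {x \<in> X. N x \<le> 1}"

definition unit_sphere :: "'a set" where
  "unit_sphere = {x \<in> X. N x = 1}"

(* The bounded linear functionals on X.  Their values outside X are unconstrained, so a functional
   is represented by many HOL functions; everything below depends only on the values on X. *)
definition dual_space :: "('a \<Rightarrow> real) set" where
  "dual_space = {f. (\<forall>x\<in>X. \<forall>y\<in>X. f (x + y) = f x + f y) \<and>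
                    (\<forall>c. \<forall>x\<in>X. f (c *\<^sub>R x) = c * f x) \<and>
                    (\<exists>K. \<forall>x\<in>X. \<bar>f x\<bar> \<le> K * N x)}"

definition dual_norm :: "('a \<Rightarrow> real) \<Rightarrow> real" where
  "dual_norm f = (SUP x\<in>unit_ball. \<bar>f x\<bar>)"

definition slice :: "('a \<Rightarrow> real) \<Rightarrow> real \<Rightarrow> 'a set" where
  "slice f \<alpha> = {y \<in> unit_ball. f y > (SUP z\<in>unit_ball. f z) - \<alpha>}"

definition is_slice :: "'a set \<Rightarrow> bool" where
  "is_slice T \<longleftrightarrow> (\<exists>f\<in>dual_space. \<exists>\<alpha>>0. T = slice f \<alpha>)"

definition supporting_functionals :: "'a \<Rightarrow> ('a \<Rightarrow> real) set" where
  "supporting_functionals x = {f \<in> dual_space. dual_norm f = 1 \<and> f x = 1}"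

definition is_supporting_slice :: "'a \<Rightarrow> 'a set \<Rightarrow> bool" where
  "is_supporting_slice x S \<longleftrightarrow> (\<exists>f\<in>supporting_functionals x. \<exists>\<alpha>>0. S = slice f \<alpha>)"

definition daugavet_point :: "'a \<Rightarrow> bool" where
  "daugavet_point x \<longleftrightarrow>
     x \<in> unit_sphere \<and> (\<forall>T. is_slice T \<longrightarrow> (SUP y\<in>T. N (x - y)) = 2)"

definition daugavet_point_relative_to :: "'a \<Rightarrow> 'a set \<Rightarrow> bool" where
  "daugavet_point_relative_to x S \<longleftrightarrow>
     x \<in> unit_sphere \<and> is_supporting_slice x S \<and>
     (\<forall>T. is_slice T \<and> T \<subseteq> S \<longrightarrow> (SUP y\<in>T. N (x - y)) = 2)"

definition relative_daugavet_point :: "'a \<Rightarrow> bool" where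
  "relative_daugavet_point x \<longleftrightarrow> (\<exists>S. daugavet_point_relative_to x S)"

definition relative_daugavet_property :: bool where
  "relative_daugavet_property \<longleftrightarrow>
     X \<noteq> {0} \<and> (\<forall>x\<in>unit_sphere. relative_daugavet_point x)"

end

end

theory Submission
  imports Defs
begin

text \<open>
  The space is a sum \<open>C\<^sub>0(0,1) \<oplus> C\<^sub>0(-1,0)\<close> of two spaces with the Daugavet property, with the
  sup norms \<open>a\<close>, \<open>b\<close> of the two summands combined by an absolute norm on the plane whose unit ball
  is a polygon.  In the positive quadrant the polygon has three facets \<open>c a + d b = 1\<close> and four
  corners.

  The Daugavet behaviour of each summand is elementary.  A bounded functional is small on some member
  of any large family of functions of bounded size with disjoint supports, so a function \<open>w\<close> in a
  slice can be changed on a tiny interval without leaving the slice.  The interval is taken where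
  \<open>\<bar>x\<bar>\<close> is almost maximal, and a value opposite in sign to \<open>x\<close> is planted there, as large as
  the norm bound on \<open>w\<close> permits (\<open>push_away_on_half\<close>).  Doing so on both summands makes the
  distance of the summands to those of \<open>x\<close> almost the sums of the norms.  The norm of the
  difference is therefore close to \<open>2\<close> as soon as the two pairs of norms lie on a common facet.

  Every slice contains a function whose pair of norms is bounded by a corner of the polygon
  (\<open>slice_meets_corner\<close>), because a linear form on a polygon is maximal at a corner.  Given \<open>x\<close>,
  choose a facet containing its pair of norms and a supporting functional built from that facet
  and from evaluations at points where the summands of \<open>x\<close> attain their norms.  There are finitely
  many corners, so a thin supporting slice only admits corners on the chosen facet.  Hence all
  slices inside it contain points almost at distance \<open>2\<close> from \<open>x\<close>, and \<open>x\<close> is a relative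
  Daugavet-point.

  On the other hand, with four corners, no pair of norms shares a facet with both end corners
  \<open>(1, 0)\<close> and \<open>(0, 1)\<close>.  Evaluation at a single point defines a slice in which all pairs of norms
  are close to such an end corner, and if \<open>x\<close> shares no facet with this corner, then \<open>x\<close> has
  distance bounded away from \<open>2\<close> to the slice.  This excludes Daugavet-points
  (\<open>not_daugavet_point_off_facet\<close>).
\<close>

section \<open>A polygonal norm on the plane\<close>

definition polygon_norm :: "real \<Rightarrow> real \<Rightarrow> real" where
  "polygon_norm a b = max (a + b / 2) (max (4/5 * a + 4/5 * b) (a / 2 + b))"

text \<open>
  The coefficients \<open>(c, d)\<close> of the linear forms whose maximum is the norm on the positive quadrant.
\<close>

definition facets :: "(real \<times> real) set" where
  "facets = {(1, 1/2), (4/5, 4/5), (1/2, 1)}"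

definition corners :: "(real \<times> real) set" where
  "corners = {(1, 0), (3/4, 1/2), (1/2, 3/4), (0, 1)}"

lemma facets_cases:
  assumes "(c, d) \<in> facets"
  obtains "c = 1" "d = 1/2" | "c = 4/5" "d = 4/5" | "c = 1/2" "d = 1"
  using assms unfolding facets_def by blast

lemma corners_cases:
  assumes "(p, q) \<in> corners"
  obtains "p = 1" "q = 0" | "p = 3/4" "q = 1/2" | "p = 1/2" "q = 3/4" | "p = 0" "q = 1"
  using assms unfolding corners_def by blast

lemma polygon_norm_commute: "polygon_norm a b = polygon_norm b a"
  unfolding polygon_norm_def by linarith

text \<open>
  The formula has no absolute values because it is only meant for nonnegative arguments.
  Its nonnegative coefficients make it monotone, hence an absolute norm.
\<close>

lemma polygon_norm_mono: "a \<le> a' \<Longrightarrow> b \<le> b' \<Longrightarrow> polygon_norm a b \<le> polygon_norm a' b'"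
  unfolding polygon_norm_def by linarith

lemma polygon_norm_add:
  "polygon_norm (a + a') (b + b') \<le> polygon_norm a b + polygon_norm a' b'"
  unfolding polygon_norm_def add_divide_distrib distrib_left by linarith

lemma polygon_norm_scale: "0 \<le> c \<Longrightarrow> polygon_norm (c * a) (c * b) = c * polygon_norm a b"
  unfolding polygon_norm_def by (simp add: max_mult_distrib_left algebra_simps)

lemma facet_le_polygon_norm: "(c, d) \<in> facets \<Longrightarrow> c * a + d * b \<le> polygon_norm a b"
  by (erule facets_cases; hypsubst; simp add: polygon_norm_def)

lemma polygon_norm_attained:
  obtains c d where "(c, d) \<in> facets" "polygon_norm a b = c * a + d * b"
proof -
  consider "polygon_norm a b = a + b / 2" | "polygon_norm a b = 4/5 * a + 4/5 * b"
    | "polygon_norm a b = a / 2 + b"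
    unfolding polygon_norm_def max_def by metis
  then show thesis
    by cases (auto simp: facets_def intro: that[of 1 "1/2"] that[of "4/5" "4/5"] that[of "1/2" 1])
qed

lemma facets_nonneg: "(c, d) \<in> facets \<Longrightarrow> 0 \<le> c \<and> 0 \<le> d \<and> c + d \<le> 2"
  by (erule facets_cases) simp_all

lemma polygon_norm_corner: "(p, q) \<in> corners \<Longrightarrow> polygon_norm p q = 1 \<and> 0 \<le> p \<and> 0 \<le> q"
  by (erule corners_cases) (simp_all add: polygon_norm_def)

text \<open>
  The value \<open>7/8\<close> is the largest one that a facet form takes at a corner off its facet:
  the form \<open>(1, 1/2)\<close> at the corner \<open>(1/2, 3/4)\<close>.  It determines how thin the supporting
  slices have to be.
\<close>

lemma corner_on_facet:
  "(c, d) \<in> facets \<Longrightarrow> (p, q) \<in> corners \<Longrightarrow> c * p + d * q > 7/8 \<Longrightarrow> c * p + d * q = 1"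
  by (erule facets_cases; erule corners_cases; hypsubst; simp)

text \<open>
  A linear form with nonnegative coefficients is dominated by a nonnegative combination of the two
  facet forms meeting at a suitable corner, with equality at that corner.  Which corner is suitable
  depends on the slope \<open>A / B\<close> compared with the slopes of the facets.
\<close>

lemma corner_maximal:
  assumes "0 \<le> A" "0 \<le> B" and ab: "0 \<le> a" "0 \<le> b" "polygon_norm a b \<le> 1"
  obtains p q where "(p, q) \<in> corners" "A * a + B * b \<le> A * p + B * q"
proof -
  have le: "a + b / 2 \<le> 1" "4/5 * a + 4/5 * b \<le> 1" "a / 2 + b \<le> 1"
    using ab unfolding polygon_norm_def by auto
  \<comment> \<open>\<open>2 * u\<close>, \<open>v\<close>, \<open>2 * w\<close> are the weights of the facets, with the middle one in the form
      \<open>a + b \<le> 5/4\<close>\<close>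
  have nonneg_comb: "A * a + B * b \<le> 2 * u + 5/4 * v + 2 * w"
    if "0 \<le> u" "0 \<le> v" "0 \<le> w" "A \<le> 2 * u + v + w" "B \<le> u + v + 2 * w" for u v w
  proof -
    have "A * a + B * b \<le> (2 * u + v + w) * a + (u + v + 2 * w) * b"
      using that ab by (intro add_mono mult_right_mono) auto
    also have "\<dots> = 2 * u * (a + b / 2) + 5/4 * v * (4/5 * a + 4/5 * b) + 2 * w * (a / 2 + b)"
      by (simp add: algebra_simps)
    also have "\<dots> \<le> 2 * u * 1 + 5/4 * v * 1 + 2 * w * 1"
      using that le by (intro add_mono mult_left_mono) auto
    finally show ?thesis by simp
  qed
  consider "2 * B \<le> A" | "B \<le> A" "A \<le> 2 * B" | "A \<le> B" "B \<le> 2 * A" | "2 * A \<le> B"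
    by linarith
  then show thesis
  proof cases
    case 1
    then have "A * a + B * b \<le> A"
      using nonneg_comb[of "A / 2" 0 0] assms by simp
    then show thesis by (intro that[of 1 0]) (simp_all add: corners_def)
  next
    case 2
    then have "A * a + B * b \<le> 2 * (A - B) + 5/4 * (2 * B - A)"
      using nonneg_comb[of "A - B" "2 * B - A" 0] by simp
    then have "A * a + B * b \<le> A * (3/4) + B * (1/2)" by argo
    then show thesis by (rule that[rotated]) (simp add: corners_def)
  next
    case 3
    then have "A * a + B * b \<le> 5/4 * (2 * A - B) + 2 * (B - A)"
      using nonneg_comb[of 0 "2 * A - B" "B - A"] by simp
    then have "A * a + B * b \<le> A * (1/2) + B * (3/4)" by argo
    then show thesis by (rule that[rotated]) (simp add: corners_def)
  next
    case 4
    then have "A * a + B * b \<le> B"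
      using nonneg_comb[of 0 0 "B / 2"] assms by simp
    then show thesis by (intro that[of 0 1]) (simp_all add: corners_def)
  qed
qed


section \<open>The function space and its two summands\<close>

definition E :: "(real \<Rightarrow>\<^sub>C real) set" where
  "E = {f :: real \<Rightarrow>\<^sub>C real. f 0 = 0 \<and> (\<forall>t. 1 \<le> \<bar>t\<bar> \<longrightarrow> f t = 0)}"

text \<open>
  The summand of \<open>f\<close> on the half-line of sign \<open>s = \<plusminus>1\<close>.  Composing with the continuous map that
  clamps the argument to this half-line gives a continuous function for every \<open>f\<close>, and the correct
  restriction when \<open>f\<close> vanishes at \<open>0\<close>.  Carrying the sign along treats both summands at once.
\<close>

definition half :: "real \<Rightarrow> (real \<Rightarrow>\<^sub>C real) \<Rightarrow> (real \<Rightarrow>\<^sub>C real)" where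
  "half s f = Bcontfun (\<lambda>t. f (s * max 0 (s * t)))"

definition nrm :: "(real \<Rightarrow>\<^sub>C real) \<Rightarrow> real" where
  "nrm f = polygon_norm (norm (half 1 f)) (norm (half (-1) f))"

lemma half_apply:
  fixes f :: "real \<Rightarrow>\<^sub>C real"
  assumes "\<bar>s\<bar> = 1"
  shows "half s f t = (if 0 \<le> s * t then f t else f 0)"
proof -
  have "(\<lambda>t. f (s * max 0 (s * t))) \<in> bcontfun"
    using norm_bounded[of f]
    by (intro bcontfun_normI[where b = "norm f"])
       (auto intro!: continuous_on_compose2[OF continuous_on_apply_bcontfun[of UNIV f]]
         continuous_intros)
  then have "half s f t = f (s * max 0 (s * t))"
    by (simp add: half_def Bcontfun_inverse)
  moreover have "s * max 0 (s * t) = (if 0 \<le> s * t then t else 0)"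
    using assms by (auto simp: abs_if max_def split: if_splits)
  ultimately show ?thesis
    by simp
qed

lemma half_add: "\<bar>s\<bar> = 1 \<Longrightarrow> half s (f + g) = half s f + half s g"
  by (auto intro!: bcontfun_eqI simp: half_apply)

lemma half_diff: "\<bar>s\<bar> = 1 \<Longrightarrow> half s (f - g) = half s f - half s g"
  by (auto intro!: bcontfun_eqI simp: half_apply)

lemma half_scaleR: "\<bar>s\<bar> = 1 \<Longrightarrow> half s (c *\<^sub>R f) = c *\<^sub>R half s f"
  by (auto intro!: bcontfun_eqI simp: half_apply)

lemma half_half: "\<bar>s\<bar> = 1 \<Longrightarrow> half s (half s f) = half s f"
  by (auto intro!: bcontfun_eqI simp: half_apply)

lemma half_opposite: "\<bar>s\<bar> = 1 \<Longrightarrow> f \<in> E \<Longrightarrow> half (- s) (half s f) = 0"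
  by (auto intro!: bcontfun_eqI simp: half_apply E_def)

lemma half_decompose: "\<bar>s\<bar> = 1 \<Longrightarrow> f \<in> E \<Longrightarrow> half s f + half (- s) f = f"
  by (auto intro!: bcontfun_eqI simp: half_apply E_def)

lemma half_in_E: "\<bar>s\<bar> = 1 \<Longrightarrow> f \<in> E \<Longrightarrow> half s f \<in> E"
  by (auto simp: half_apply E_def)

lemma abs_le_norm_half:
  fixes f :: "real \<Rightarrow>\<^sub>C real"
  shows "\<bar>s\<bar> = 1 \<Longrightarrow> 0 \<le> s * t \<Longrightarrow> \<bar>f t\<bar> \<le> norm (half s f)"
  using norm_bounded[of "half s f" t] by (simp add: half_apply)

lemma norm_half_le:
  fixes f :: "real \<Rightarrow>\<^sub>C real"
  assumes "\<bar>s\<bar> = 1" "\<And>t. 0 \<le> s * t \<Longrightarrow> \<bar>f t\<bar> \<le> B"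
  shows "norm (half s f) \<le> B"
  using assms by (intro norm_bound) (auto simp: half_apply)

lemma norm_half_le_norm: "\<bar>s\<bar> = 1 \<Longrightarrow> norm (half s f) \<le> norm f"
  by (rule norm_half_le) (use norm_bounded[of f] in auto)

lemma nrm_sides: "\<bar>s\<bar> = 1 \<Longrightarrow> nrm f = polygon_norm (norm (half s f)) (norm (half (- s) f))"
  by (auto simp: nrm_def polygon_norm_commute abs_if split: if_splits)

lemma norm_le_nrm: "norm f \<le> nrm f"
proof (rule norm_bound)
  fix t
  have "\<bar>f t\<bar> \<le> norm (half 1 f) \<or> \<bar>f t\<bar> \<le> norm (half (-1) f)"
    using abs_le_norm_half[of 1 t f] abs_le_norm_half[of "-1" t f] by force
  then show "norm (f t) \<le> nrm f"
    using norm_ge_zero[of "half 1 f"] norm_ge_zero[of "half (-1) f"]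
    unfolding nrm_def polygon_norm_def real_norm_def by linarith
qed

lemma nrm_le: "nrm f \<le> 2 * norm f"
  using norm_half_le_norm[of 1 f] norm_half_le_norm[of "-1" f]
    norm_ge_zero[of "half 1 f"] norm_ge_zero[of "half (-1) f"]
  unfolding nrm_def polygon_norm_def max.bounded_iff by linarith

lemma nrm_triangle: "nrm (f + g) \<le> nrm f + nrm g"
proof -
  have "nrm (f + g) \<le> polygon_norm (norm (half 1 f) + norm (half 1 g))
                            (norm (half (-1) f) + norm (half (-1) g))"
    unfolding nrm_def by (intro polygon_norm_mono) (auto simp: half_add norm_triangle_ineq)
  also have "\<dots> \<le> nrm f + nrm g"
    unfolding nrm_def by (rule polygon_norm_add)
  finally show ?thesis .
qed

lemma nrm_scaleR: "nrm (c *\<^sub>R f) = \<bar>c\<bar> * nrm f"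
  by (simp add: nrm_def half_scaleR polygon_norm_scale)

lemma nrm_nonneg: "0 \<le> nrm f"
  using norm_ge_zero[of f] norm_le_nrm[of f] by linarith

lemma subspace_E: "subspace E"
  by (auto simp: subspace_def E_def)

lemma closed_E: "closed E"
  unfolding closed_sequential_limits
proof safe
  fix f l assume "\<forall>n. f n \<in> E" and lim: "f \<longlonglongrightarrow> l"
  have "l t = 0" if "\<And>n. f n t = 0" for t
    using tendsto_uniform_limitI[OF tendsto_bcontfun_uniform_limit[OF lim], of t] that
    by (simp add: LIMSEQ_const_iff)
  then show "l \<in> E"
    using \<open>\<forall>n. f n \<in> E\<close> by (simp add: E_def)
qed

text \<open>
  The norm is equivalent to the sup norm, for which the space is closed.
\<close>

lemma banach_space: "banach_space_on E nrm"
proof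
  show "subspace E" by (rule subspace_E)
next
  fix f :: "real \<Rightarrow>\<^sub>C real"
  show "nrm f = 0 \<longleftrightarrow> f = 0"
    using norm_le_nrm[of f] nrm_le[of f] by auto
next
  fix \<sigma> :: "nat \<Rightarrow> real \<Rightarrow>\<^sub>C real"
  assume in_E: "\<And>n. \<sigma> n \<in> E"
    and cauchy: "\<And>e. e > 0 \<Longrightarrow> \<exists>M::nat. \<forall>m\<ge>M. \<forall>n\<ge>M. nrm (\<sigma> m - \<sigma> n) < e"
  have "Cauchy \<sigma>"
    by (rule CauchyI) (meson cauchy norm_le_nrm le_less_trans)
  then obtain l where lim: "\<sigma> \<longlonglongrightarrow> l"
    by (auto simp: Cauchy_convergent_iff convergent_def)
  have "l \<in> E"
    using closed_sequentially[OF closed_E _ lim] in_E by blast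
  moreover have "(\<lambda>n. nrm (\<sigma> n - l)) \<longlonglongrightarrow> 0"
  proof (rule tendsto_sandwich[where f = "\<lambda>_. 0"])
    show "(\<lambda>n. 2 * norm (\<sigma> n - l)) \<longlonglongrightarrow> 0"
      using lim by (intro tendsto_mult_right_zero) (simp add: LIM_zero tendsto_norm_zero)
  qed (auto simp: nrm_nonneg nrm_le)
  ultimately show "\<exists>l\<in>E. (\<lambda>n. nrm (\<sigma> n - l)) \<longlonglongrightarrow> 0" by blast
qed (auto simp: nrm_nonneg nrm_scaleR nrm_triangle)

interpretation E: banach_space_on E nrm by (rule banach_space)


section \<open>Functionals and slices\<close>

lemma dual_linear:
  assumes "\<psi> \<in> dual_space E nrm"
  shows "f \<in> E \<Longrightarrow> g \<in> E \<Longrightarrow> \<psi> (f + g) = \<psi> f + \<psi> g"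
    and "f \<in> E \<Longrightarrow> \<psi> (c *\<^sub>R f) = c * \<psi> f"
    and "(\<And>i. i \<in> I \<Longrightarrow> h i \<in> E) \<Longrightarrow> \<psi> (\<Sum>i\<in>I. h i) = (\<Sum>i\<in>I. \<psi> (h i))"
proof -
  show add: "\<psi> (f + g) = \<psi> f + \<psi> g" if "f \<in> E" "g \<in> E" for f g
    using assms that by (auto simp: dual_space_def)
  show scale: "\<psi> (c *\<^sub>R f) = c * \<psi> f" if "f \<in> E" for c f
    using assms that by (auto simp: dual_space_def)
  have zero: "\<psi> 0 = 0"
    using scale[of 0 0] subspace_0[OF subspace_E] by simp
  show "\<psi> (\<Sum>i\<in>I. h i) = (\<Sum>i\<in>I. \<psi> (h i))" if "\<And>i. i \<in> I \<Longrightarrow> h i \<in> E"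
    using that
    by (induction I rule: infinite_finite_induct)
       (auto simp: zero add subspace_sum[OF subspace_E])
qed

lemma dual_bounded:
  assumes "\<psi> \<in> dual_space E nrm"
  obtains K where "0 \<le> K" "\<And>f. f \<in> E \<Longrightarrow> \<bar>\<psi> f\<bar> \<le> K * nrm f"
proof -
  obtain K where K: "\<And>f. f \<in> E \<Longrightarrow> \<bar>\<psi> f\<bar> \<le> K * nrm f"
    using assms unfolding dual_space_def by blast
  show thesis
  proof (rule that[of "\<bar>K\<bar>"])
    show "\<bar>\<psi> f\<bar> \<le> \<bar>K\<bar> * nrm f" if "f \<in> E" for f
      using K[OF that] mult_right_mono[OF abs_ge_self[of K] nrm_nonneg[of f]] by linarith
  qed auto
qed

lemma dual_bdd_above:
  assumes "\<psi> \<in> dual_space E nrm"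
  shows "bdd_above (\<psi> ` unit_ball E nrm)"
proof -
  obtain K where K: "0 \<le> K" "\<And>f. f \<in> E \<Longrightarrow> \<bar>\<psi> f\<bar> \<le> K * nrm f"
    using dual_bounded[OF assms] by blast
  have "\<psi> f \<le> K" if "f \<in> unit_ball E nrm" for f
    using K(2)[of f] mult_left_le[of "nrm f" K] K(1) that by (auto simp: unit_ball_def)
  then show ?thesis by (rule bdd_aboveI2)
qed

lemma zero_in_unit_ball: "0 \<in> unit_ball E nrm"
  using subspace_0[OF subspace_E] E.zero_iff[of 0] by (simp add: unit_ball_def)

lemma slice_nonempty:
  assumes "\<psi> \<in> dual_space E nrm" "0 < \<beta>"
  obtains f where "f \<in> slice E nrm \<psi> \<beta>"
proof -
  have "\<exists>f\<in>unit_ball E nrm. (SUP z\<in>unit_ball E nrm. \<psi> z) - \<beta> < \<psi> f"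
    using less_cSUP_iff[OF _ dual_bdd_above[OF assms(1)],
        of "(SUP z\<in>unit_ball E nrm. \<psi> z) - \<beta>"] zero_in_unit_ball assms(2)
    by auto
  then show thesis using that by (auto simp: slice_def)
qed

lemma nrm_diff_le_two: "f \<in> unit_ball E nrm \<Longrightarrow> g \<in> unit_ball E nrm \<Longrightarrow> nrm (f - g) \<le> 2"
  using nrm_triangle[of f "- g"] nrm_scaleR[of "-1" g] by (simp add: unit_ball_def)


section \<open>Perturbations on small intervals\<close>

definition tent :: "real \<Rightarrow> real \<Rightarrow> (real \<Rightarrow>\<^sub>C real)" where
  "tent m r = Bcontfun (\<lambda>t. max 0 (1 - \<bar>t - m\<bar> / r))"

lemma tent_apply:
  assumes "0 < r"
  shows "tent m r t = max 0 (1 - \<bar>t - m\<bar> / r)"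
proof -
  have "(\<lambda>t. max 0 (1 - \<bar>t - m\<bar> / r)) \<in> bcontfun"
    using assms by (intro bcontfun_normI[where b = 1]) (auto intro!: continuous_intros)
  then show ?thesis
    by (simp add: tent_def Bcontfun_inverse)
qed

lemma tent_bounds: "0 < r \<Longrightarrow> 0 \<le> tent m r t \<and> tent m r t \<le> 1"
  by (simp add: tent_apply)

lemma tent_eq_0_iff: "0 < r \<Longrightarrow> tent m r t = 0 \<longleftrightarrow> r \<le> \<bar>t - m\<bar>"
  by (auto simp: tent_apply max_def field_simps)

text \<open>
  If \<open>\<psi>\<close> were large on all members, then adding them up with the signs of their \<open>\<psi>\<close>-values would
  give a function bounded by \<open>C\<close> on which \<open>\<psi>\<close> is arbitrarily large as the family grows.
\<close>

lemma small_on_disjoint_family: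
  fixes h :: "nat \<Rightarrow> real \<Rightarrow>\<^sub>C real"
  assumes \<psi>: "\<psi> \<in> dual_space E nrm" and "0 < \<delta>"
  obtains k :: nat where "0 < k"
    "\<And>h. (\<And>i. i < k \<Longrightarrow> h i \<in> E) \<Longrightarrow> (\<And>t. (\<Sum>i<k. \<bar>h i t\<bar>) \<le> C) \<Longrightarrow> \<exists>i<k. \<bar>\<psi> (h i)\<bar> < \<delta>"
proof -
  obtain K where K: "0 \<le> K" "\<And>f. f \<in> E \<Longrightarrow> \<bar>\<psi> f\<bar> \<le> K * nrm f"
    using dual_bounded[OF \<psi>] by blast
  obtain k :: nat where k: "\<bar>K * (2 * C)\<bar> / \<delta> < k"
    using reals_Archimedean2 by blast
  show thesis
  proof (rule that[of k])
    show "0 < k"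
      using k \<open>0 < \<delta>\<close> by (smt (verit) divide_nonneg_pos of_nat_0_less_iff)
    fix h :: "nat \<Rightarrow> real \<Rightarrow>\<^sub>C real"
    assume h: "\<And>i. i < k \<Longrightarrow> h i \<in> E" and sum_le: "\<And>t. (\<Sum>i<k. \<bar>h i t\<bar>) \<le> C"
    show "\<exists>i<k. \<bar>\<psi> (h i)\<bar> < \<delta>"
    proof (rule ccontr)
      assume "\<not> ?thesis"
      then have large: "\<delta> \<le> \<bar>\<psi> (h i)\<bar>" if "i < k" for i
        using that by force
      define H where "H = (\<Sum>i<k. sgn (\<psi> (h i)) *\<^sub>R h i)"
      have H_apply: "H t = (\<Sum>i<k. sgn (\<psi> (h i)) * h i t)" for t
      proof -
        have "(\<Sum>i<n. sgn (\<psi> (h i)) *\<^sub>R h i) t = (\<Sum>i<n. sgn (\<psi> (h i)) * h i t)" for n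
          by (induction n) auto
        then show ?thesis by (simp add: H_def)
      qed
      have "H \<in> E"
        unfolding H_def using h
        by (intro subspace_sum[OF subspace_E] subspace_scale[OF subspace_E]) auto
      have "norm H \<le> C"
      proof (rule norm_bound)
        fix t
        have "norm (H t) \<le> (\<Sum>i<k. \<bar>sgn (\<psi> (h i)) * h i t\<bar>)"
          unfolding H_apply real_norm_def by (rule sum_abs)
        also have "\<dots> \<le> (\<Sum>i<k. \<bar>h i t\<bar>)"
          by (intro sum_mono) (auto simp: abs_mult sgn_if)
        finally show "norm (H t) \<le> C" using sum_le[of t] by linarith
      qed
      have "k * \<delta> \<le> (\<Sum>i<k. \<bar>\<psi> (h i)\<bar>)"
        using sum_mono[of "{..<k}" "\<lambda>_. \<delta>" "\<lambda>i. \<bar>\<psi> (h i)\<bar>"] large by simp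
      also have "\<dots> = \<psi> H"
        unfolding H_def using h
        by (subst dual_linear(3)[OF \<psi>])
           (auto simp: dual_linear(2)[OF \<psi>] abs_sgn mult.commute subspace_scale[OF subspace_E]
             intro!: sum.cong)
      also have "\<dots> \<le> K * nrm H"
        using K(2)[OF \<open>H \<in> E\<close>] by linarith
      also have "\<dots> \<le> K * (2 * C)"
        using K(1) nrm_le[of H] \<open>norm H \<le> C\<close> by (intro mult_left_mono) auto
      finally show False
        using k \<open>0 < \<delta>\<close> by (simp add: field_simps)
    qed
  qed
qed

text \<open>
  The interval is cut into many pieces.  A pointwise convex combination of \<open>w\<close> and the constant
  \<open>\<kappa>\<close>, weighted by a tent over one piece, never exceeds the larger of their absolute values.
  For different pieces these modifications of \<open>w\<close> have disjoint supports, so one of them hardly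
  affects \<open>\<psi>\<close>.
\<close>

lemma plant_value:
  assumes \<psi>: "\<psi> \<in> dual_space E nrm" and "0 < \<delta>" and w: "w \<in> E"
    and "u < v" and inside: "\<And>t. t \<in> {u<..<v} \<Longrightarrow> 0 < s * t \<and> s * t < 1" and s: "\<bar>s\<bar> = 1"
  obtains y where "y \<in> E" "\<bar>\<psi> y - \<psi> w\<bar> < \<delta>" "half (- s) y = half (- s) w"
    "norm (half s y) \<le> max (norm (half s w)) \<bar>\<kappa>\<bar>" "\<exists>t\<in>{u<..<v}. y t = \<kappa>"
proof -
  obtain k :: nat where "0 < k" and k:
    "\<And>h. (\<And>i. i < k \<Longrightarrow> h i \<in> E) \<Longrightarrow> (\<And>t. (\<Sum>i<k. \<bar>h i t\<bar>) \<le> \<bar>\<kappa>\<bar> + norm w)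
      \<Longrightarrow> \<exists>i<k. \<bar>\<psi> (h i)\<bar> < \<delta>"
    using small_on_disjoint_family[OF \<psi> \<open>0 < \<delta>\<close>] by blast
  define r where "r = (v - u) / (2 * k)"
  define m where "m i = u + (2 * real i + 1) * r" for i :: nat
  have "0 < r" using \<open>u < v\<close> \<open>0 < k\<close> by (simp add: r_def)
  \<comment> \<open>the tents have width \<open>2 * r\<close>, and \<open>k\<close> of them fill the interval from \<open>u\<close> to \<open>v\<close>\<close>
  have support: "t \<in> {u<..<v}" if "i < k" "tent (m i) r t \<noteq> 0" for i t
  proof -
    have "\<bar>t - m i\<bar> < r" using that tent_eq_0_iff[OF \<open>0 < r\<close>, of "m i" t] by auto
    moreover have "r \<le> m i - u"
      using \<open>0 < r\<close> by (simp add: m_def algebra_simps)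
    moreover have "m i + r \<le> v"
    proof -
      have "m i + r = u + (2 * real (Suc i)) * r" by (simp add: m_def algebra_simps)
      also have "\<dots> \<le> u + (2 * real k) * r"
        using that(1) \<open>0 < r\<close> by (intro add_left_mono mult_right_mono) auto
      also have "\<dots> = v" using \<open>0 < k\<close> by (simp add: r_def)
      finally show ?thesis .
    qed
    ultimately show ?thesis by auto
  qed
  have disjoint: "i = j" if "tent (m i) r t \<noteq> 0" "tent (m j) r t \<noteq> 0" for i j t
  proof (rule ccontr)
    assume "i \<noteq> j"
    then have "2 * r \<le> \<bar>real i - real j\<bar> * (2 * r)"
      using \<open>0 < r\<close> by (auto simp: mult_le_cancel_right1)
    also have "\<dots> = \<bar>m i - m j\<bar>"
    proof -
      have "m i - m j = (real i - real j) * (2 * r)" by (simp add: m_def algebra_simps)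
      then show ?thesis using \<open>0 < r\<close> by (simp add: abs_mult)
    qed
    finally show False
      using that tent_eq_0_iff[OF \<open>0 < r\<close>, of "m i" t] tent_eq_0_iff[OF \<open>0 < r\<close>, of "m j" t]
      by linarith
  qed
  define h where "h i = Bcontfun (\<lambda>t. tent (m i) r t * (\<kappa> - w t))" for i
  have h_bound: "\<bar>tent (m i) r t * (\<kappa> - w t)\<bar> \<le> \<bar>\<kappa>\<bar> + norm w" for i t
  proof -
    have "\<bar>tent (m i) r t\<bar> * \<bar>\<kappa> - w t\<bar> \<le> 1 * \<bar>\<kappa> - w t\<bar>"
      using tent_bounds[OF \<open>0 < r\<close>, of "m i" t] by (intro mult_right_mono) auto
    also have "\<dots> \<le> \<bar>\<kappa>\<bar> + norm w"
      using norm_bounded[of w t] by auto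
    finally show ?thesis by (simp add: abs_mult)
  qed
  have h_apply: "h i t = tent (m i) r t * (\<kappa> - w t)" for i t
  proof -
    have "(\<lambda>t. tent (m i) r t * (\<kappa> - w t)) \<in> bcontfun"
      using h_bound
      by (intro bcontfun_normI[where b = "\<bar>\<kappa>\<bar> + norm w"] continuous_intros) auto
    then show ?thesis by (simp add: h_def Bcontfun_inverse)
  qed
  have tent_outside: "tent (m i) r t = 0" if "i < k" "\<not> (0 < s * t \<and> s * t < 1)" for i t
    using support[OF that(1)] inside that(2) by blast
  have h_E: "h i \<in> E" if "i < k" for i
  proof -
    have "\<not> (0 < s * t \<and> s * t < 1)" if "1 \<le> \<bar>t\<bar>" for t
      using that s by (auto simp: abs_if split: if_splits)
    then show ?thesis
      using tent_outside[OF that] by (auto simp: E_def h_apply)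
  qed
  have "(\<Sum>i<k. \<bar>h i t\<bar>) \<le> \<bar>\<kappa>\<bar> + norm w" for t
  proof (cases "\<exists>j<k. tent (m j) r t \<noteq> 0")
    case True
    then obtain j where j: "j < k" "tent (m j) r t \<noteq> 0" by blast
    have "h i t = 0" if "i \<noteq> j" for i
    proof -
      have "tent (m i) r t = 0" using disjoint[OF j(2), of i] that by blast
      then show ?thesis by (simp add: h_apply)
    qed
    then have "(\<Sum>i<k. \<bar>h i t\<bar>) = (\<Sum>i\<in>{j}. \<bar>h i t\<bar>)"
      using j(1) by (intro sum.mono_neutral_right) auto
    then show ?thesis using h_bound[of j t] by (simp add: h_apply)
  next
    case False
    then have "(\<Sum>i<k. \<bar>h i t\<bar>) = 0" by (simp add: h_apply)
    then show ?thesis by (simp add: add_nonneg_nonneg)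
  qed
  then obtain i where i: "i < k" "\<bar>\<psi> (h i)\<bar> < \<delta>"
    using k[of h] h_E by blast
  define y where "y = w + h i"
  have y_apply: "y t = (1 - tent (m i) r t) * w t + tent (m i) r t * \<kappa>" for t
    by (simp add: y_def h_apply algebra_simps)
  show thesis
  proof (rule that[of y])
    show "y \<in> E"
      unfolding y_def using w h_E[OF i(1)] by (rule subspace_add[OF subspace_E])
    show "\<bar>\<psi> y - \<psi> w\<bar> < \<delta>"
      using i dual_linear(1)[OF \<psi> w h_E[OF i(1)]] by (simp add: y_def)
    show "half (- s) y = half (- s) w"
    proof (rule bcontfun_eqI)
      fix t
      have "tent (m i) r t = 0" if "0 \<le> - s * t"
        by (rule tent_outside[OF i(1)]) (use that in auto)
      moreover have "tent (m i) r 0 = 0"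
        by (rule tent_outside[OF i(1)]) auto
      ultimately show "half (- s) y t = half (- s) w t"
        using s by (auto simp: half_apply y_apply)
    qed
    show "norm (half s y) \<le> max (norm (half s w)) \<bar>\<kappa>\<bar>"
    proof (rule norm_half_le[OF s])
      fix t assume t: "0 \<le> s * t"
      let ?b = "tent (m i) r t" and ?M = "max (norm (half s w)) \<bar>\<kappa>\<bar>"
      have b: "0 \<le> ?b" "?b \<le> 1" using tent_bounds[OF \<open>0 < r\<close>] by auto
      have "\<bar>y t\<bar> \<le> \<bar>(1 - ?b) * w t\<bar> + \<bar>?b * \<kappa>\<bar>"
        unfolding y_apply by (rule abs_triangle_ineq)
      also have "\<dots> = (1 - ?b) * \<bar>w t\<bar> + ?b * \<bar>\<kappa>\<bar>"
        using b by (simp add: abs_mult)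
      also have "\<dots> \<le> (1 - ?b) * ?M + ?b * ?M"
        using b abs_le_norm_half[OF s t, of w] by (intro add_mono mult_left_mono) auto
      finally show "\<bar>y t\<bar> \<le> ?M" by (simp add: algebra_simps)
    qed
    have "tent (m i) r (m i) = 1" using \<open>0 < r\<close> by (simp add: tent_apply)
    then show "\<exists>t\<in>{u<..<v}. y t = \<kappa>"
      using support[OF i(1), of "m i"] by (intro bexI[of _ "m i"]) (auto simp: y_apply)
  qed
qed

text \<open>
  The norm is attained because functions in the space vanish outside a compact interval.  The point
  can be chosen in the open interval, even if the summand is zero.
\<close>

lemma half_norm_attained:
  assumes "x \<in> E" and s: "\<bar>s\<bar> = 1"
  obtains t where "0 < s * t" "s * t < 1" "\<bar>x t\<bar> = norm (half s x)"
proof -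
  have "\<exists>t\<in>{-1..1}. \<forall>t'\<in>{-1..1}. \<bar>half s x t'\<bar> \<le> \<bar>half s x t\<bar>"
    by (rule continuous_attains_sup) (auto intro!: continuous_intros)
  then obtain t where t: "\<And>t'. t' \<in> {-1..1} \<Longrightarrow> \<bar>half s x t'\<bar> \<le> \<bar>half s x t\<bar>"
    by blast
  have outside: "half s x t' = 0" if "1 \<le> \<bar>t'\<bar> \<or> s * t' \<le> 0" for t'
    using that assms(1) s by (auto simp: half_apply E_def)
  have "\<bar>half s x t'\<bar> \<le> \<bar>half s x t\<bar>" for t'
    using t[of t'] outside[of t'] by (cases "t' \<in> {-1..1}") auto
  then have eq: "norm (half s x) = \<bar>half s x t\<bar>"
    using norm_bounded[of "half s x" t] by (intro antisym norm_bound) auto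
  show thesis
  proof (cases "half s x t = 0")
    case True
    have s2: "s * (s / 2) = 1/2" using s by (auto simp: abs_if split: if_splits)
    have "x (s / 2) = 0"
      using True eq abs_le_norm_half[OF s, of "s / 2" x] s2 by simp
    then show thesis
      using that[of "s / 2"] s2 True eq by simp
  next
    case False
    then have "\<bar>t\<bar> < 1" "0 < s * t" using outside[of t] by force+
    then show thesis
      using that[of t] s eq by (auto simp: half_apply abs_if split: if_splits)
  qed
qed

lemma half_norm_almost_attained:
  assumes "x \<in> E" and s: "\<bar>s\<bar> = 1" and "0 < \<epsilon>"
  obtains u v \<tau> where "u < v" "\<bar>\<tau>\<bar> = 1" "\<And>t. t \<in> {u<..<v} \<Longrightarrow> 0 < s * t \<and> s * t < 1"
    "\<And>t. t \<in> {u<..<v} \<Longrightarrow> norm (half s x) - \<epsilon> < \<tau> * x t"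
proof -
  obtain t0 where t0: "0 < s * t0" "s * t0 < 1" "\<bar>x t0\<bar> = norm (half s x)"
    using half_norm_attained[OF assms(1,2)] .
  define \<tau> :: real where "\<tau> = (if 0 \<le> x t0 then 1 else -1)"
  have "\<tau> * x t0 = norm (half s x)"
    using t0(3) by (auto simp: \<tau>_def)
  define U where "U = {t. 0 < s * t} \<inter> {t. s * t < 1} \<inter> {t. norm (half s x) - \<epsilon> < \<tau> * x t}"
  have "open U"
    unfolding U_def by (intro open_Int open_Collect_less continuous_intros) auto
  moreover have "t0 \<in> U"
    using t0 \<open>\<tau> * x t0 = _\<close> \<open>0 < \<epsilon>\<close> by (simp add: U_def)
  ultimately obtain e where "0 < e" "ball t0 e \<subseteq> U"
    unfolding open_contains_ball by blast
  then have e: "t \<in> U" if "t \<in> {t0 - e<..<t0 + e}" for t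
    using that by (auto simp: ball_eq_greaterThanLessThan subset_iff)
  show thesis
  proof (rule that[of "t0 - e" "t0 + e" \<tau>])
    show "\<bar>\<tau>\<bar> = 1" by (simp add: \<tau>_def)
  qed (use e \<open>0 < e\<close> in \<open>auto simp: U_def\<close>)
qed

text \<open>
  This is the Daugavet property of one summand, with the other one left untouched.  The bound \<open>p\<close>
  may exceed the norm of the summand of \<open>w\<close>: the planted value is \<open>\<plusminus>p\<close> in any case.
\<close>

lemma push_away_on_half:
  assumes \<psi>: "\<psi> \<in> dual_space E nrm" and "0 < \<delta>" "0 < \<epsilon>" and w: "w \<in> E" and x: "x \<in> E"
    and s: "\<bar>s\<bar> = 1" and p: "norm (half s w) \<le> p"
  obtains y where "y \<in> E" "\<bar>\<psi> y - \<psi> w\<bar> < \<delta>" "half (- s) y = half (- s) w"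
    "norm (half s y) \<le> p" "norm (half s x) + p - \<epsilon> < norm (half s (x - y))"
proof -
  obtain u v \<tau> where uv: "u < v" and \<tau>: "\<bar>\<tau>\<bar> = 1"
    and inside: "\<And>t. t \<in> {u<..<v} \<Longrightarrow> 0 < s * t \<and> s * t < 1"
    and near: "\<And>t. t \<in> {u<..<v} \<Longrightarrow> norm (half s x) - \<epsilon> < \<tau> * x t"
    using half_norm_almost_attained[OF x s \<open>0 < \<epsilon>\<close>] by blast
  have "0 \<le> p" using p norm_ge_zero order_trans by blast
  obtain y t where y: "y \<in> E" "\<bar>\<psi> y - \<psi> w\<bar> < \<delta>" "half (- s) y = half (- s) w"
    "norm (half s y) \<le> max (norm (half s w)) \<bar>- \<tau> * p\<bar>"
    and t: "t \<in> {u<..<v}" "y t = - \<tau> * p"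
    using plant_value[OF \<psi> \<open>0 < \<delta>\<close> w uv inside s] by metis
  have "\<tau> * (x - y) t = \<tau> * x t + p"
    using t(2) \<tau> by (auto simp: abs_if algebra_simps split: if_splits)
  then have "norm (half s x) + p - \<epsilon> < \<tau> * (x - y) t"
    using near[OF t(1)] by linarith
  also have "\<dots> \<le> \<bar>(x - y) t\<bar>"
    using \<tau> by (auto simp: abs_if split: if_splits)
  also have "\<dots> \<le> norm (half s (x - y))"
    using inside[OF t(1)] by (intro abs_le_norm_half[OF s]) auto
  finally show thesis
    using y p \<tau> \<open>0 \<le> p\<close> by (intro that[of y]) (auto simp: abs_mult)
qed


section \<open>The relative Daugavet property\<close>

text \<open>
  The witness \<open>e\<close> is the summand of \<open>w\<close>, normalised and with the sign that makes \<open>\<psi>\<close> nonnegative.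
  It is \<open>0\<close> if that summand or its \<open>\<psi>\<close>-value is zero, so its norm is only bounded by \<open>1\<close>.
\<close>

lemma align_half:
  assumes \<psi>: "\<psi> \<in> dual_space E nrm" and w: "w \<in> E" and s: "\<bar>s\<bar> = 1"
  obtains e where "e \<in> E" "half s e = e" "half (- s) e = 0" "norm e \<le> 1" "0 \<le> \<psi> e"
    "\<psi> (half s w) \<le> \<psi> e * norm (half s w)"
proof -
  let ?w = "half s w"
  have wE: "?w \<in> E" using half_in_E[OF s w] .
  define e where "e = (sgn (\<psi> ?w) / norm ?w) *\<^sub>R ?w"
  have \<psi>e: "\<psi> e = \<bar>\<psi> ?w\<bar> / norm ?w"
    using dual_linear(2)[OF \<psi> wE] by (simp add: e_def abs_sgn mult.commute)
  show thesis
  proof (rule that[of e])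
    show "e \<in> E" unfolding e_def by (rule subspace_scale[OF subspace_E wE])
    show "half s e = e" "half (- s) e = 0"
      using s w by (simp_all add: e_def half_scaleR half_half half_opposite)
    show "norm e \<le> 1" by (auto simp: e_def sgn_if)
    show "0 \<le> \<psi> e" by (simp add: \<psi>e)
    show "\<psi> ?w \<le> \<psi> e * norm ?w"
    proof (cases "?w = 0")
      case True
      then show ?thesis using dual_linear(2)[OF \<psi> wE, of 0] by simp
    qed (simp add: \<psi>e)
  qed
qed

text \<open>
  Rescaling the two summands of a point of the slice separately turns \<open>\<psi>\<close> into a linear form in
  the pair of their norms.  Moving to the corner where this form is maximal does not decrease \<open>\<psi>\<close>.
\<close>

lemma slice_meets_corner:
  assumes \<psi>: "\<psi> \<in> dual_space E nrm" and "0 < \<beta>"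
  obtains w p q where "w \<in> slice E nrm \<psi> \<beta>" "(p, q) \<in> corners"
    "norm (half 1 w) \<le> p" "norm (half (-1) w) \<le> q"
proof -
  obtain z where z: "z \<in> slice E nrm \<psi> \<beta>"
    using slice_nonempty[OF assms] .
  then have zE: "z \<in> E" and zN: "nrm z \<le> 1"
    by (auto simp: slice_def unit_ball_def)
  obtain e where e: "e \<in> E" "half 1 e = e" "half (-1) e = 0" "norm e \<le> 1" "0 \<le> \<psi> e"
    "\<psi> (half 1 z) \<le> \<psi> e * norm (half 1 z)"
    using align_half[OF \<psi> zE, of 1] by auto
  obtain e' where e': "e' \<in> E" "half (-1) e' = e'" "half 1 e' = 0" "norm e' \<le> 1" "0 \<le> \<psi> e'"
    "\<psi> (half (-1) z) \<le> \<psi> e' * norm (half (-1) z)"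
    using align_half[OF \<psi> zE, of "-1"] by auto
  obtain p q where pq: "(p, q) \<in> corners"
    and le: "\<psi> e * norm (half 1 z) + \<psi> e' * norm (half (-1) z) \<le> \<psi> e * p + \<psi> e' * q"
    using corner_maximal[OF e(5) e'(5) norm_ge_zero norm_ge_zero zN[unfolded nrm_def]] by blast
  define w where "w = p *\<^sub>R e + q *\<^sub>R e'"
  have nonneg: "0 \<le> p" "0 \<le> q" and pq1: "polygon_norm p q = 1" using polygon_norm_corner[OF pq] by auto
  have halves: "half 1 w = p *\<^sub>R e" "half (-1) w = q *\<^sub>R e'"
    using e e' by (simp_all add: w_def half_add half_scaleR)
  have norms: "norm (half 1 w) \<le> p" "norm (half (-1) w) \<le> q"
    using e(4) e'(4) nonneg by (auto simp: halves mult_left_le)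
  have "w \<in> unit_ball E nrm"
    using e(1) e'(1) polygon_norm_mono[OF norms] pq1
    by (simp add: unit_ball_def nrm_def w_def subspace_add[OF subspace_E] subspace_scale[OF subspace_E])
  moreover have "\<psi> z \<le> \<psi> w"
  proof -
    have "\<psi> z = \<psi> (half 1 z) + \<psi> (half (-1) z)"
      using half_decompose[of 1 z] zE
      by (metis abs_1 abs_minus_cancel dual_linear(1)[OF \<psi>] half_in_E)
    also have "\<dots> \<le> \<psi> e * p + \<psi> e' * q" using e(6) e'(6) le by linarith
    also have "\<dots> = \<psi> w"
      using e(1) e'(1)
      by (simp add: w_def dual_linear[OF \<psi>] subspace_scale[OF subspace_E] mult.commute)
    finally show ?thesis .
  qed
  ultimately have "w \<in> slice E nrm \<psi> \<beta>"
    using z by (auto simp: slice_def)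
  then show thesis using that pq norms by blast
qed

text \<open>
  Let \<open>T\<close> be a slice inside the supporting slice \<open>S\<close>.  A point \<open>w\<close> of \<open>T\<close> bounded by a corner
  \<open>(p, q)\<close> also lies in \<open>S\<close>, which forces the corner onto the facet \<open>(c, d)\<close> of \<open>x\<close>.  Pushing both
  summands of \<open>w\<close> away from \<open>x\<close> gives a point of \<open>T\<close> whose distance to \<open>x\<close>, estimated by the facet
  form, is almost the value \<open>1\<close> of the form at \<open>x\<close> plus its value \<open>1\<close> at the corner.
\<close>

lemma relative_daugavet_point:
  assumes "x \<in> unit_sphere E nrm"
  shows "relative_daugavet_point E nrm x"
proof -
  have xE: "x \<in> E" and xN: "nrm x = 1" using assms by (auto simp: unit_sphere_def)
  obtain c d where cd: "(c, d) \<in> facets" and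
    cd1: "c * norm (half 1 x) + d * norm (half (-1) x) = 1"
    using polygon_norm_attained xN unfolding nrm_def by metis
  have cd0: "0 \<le> c" "0 \<le> d" "c + d \<le> 2" using facets_nonneg[OF cd] by auto
  have cd_le: "c * norm (half 1 f) + d * norm (half (-1) f) \<le> nrm f" for f
    unfolding nrm_def by (rule facet_le_polygon_norm[OF cd])
  obtain t where t: "0 < t" "\<bar>x t\<bar> = norm (half 1 x)"
    using half_norm_attained[OF xE, of 1] by auto
  obtain t' where t': "t' < 0" "\<bar>x t'\<bar> = norm (half (-1) x)"
    using half_norm_attained[OF xE, of "-1"] by auto
  define \<phi> where "\<phi> f = c * (sgn (x t) * f t) + d * (sgn (x t') * f t')" for f :: "real \<Rightarrow>\<^sub>C real"
  have \<phi>_halves: "\<bar>\<phi> f\<bar> \<le> c * norm (half 1 f) + d * norm (half (-1) f)" for f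
  proof -
    have "\<bar>\<phi> f\<bar> \<le> c * \<bar>sgn (x t) * f t\<bar> + d * \<bar>sgn (x t') * f t'\<bar>"
      unfolding \<phi>_def using cd0 by (intro order_trans[OF abs_triangle_ineq]) (simp add: abs_mult)
    also have "\<dots> \<le> c * \<bar>f t\<bar> + d * \<bar>f t'\<bar>"
      using cd0 by (intro add_mono mult_left_mono) (auto simp: abs_mult sgn_if)
    also have "\<dots> \<le> c * norm (half 1 f) + d * norm (half (-1) f)"
      using cd0 t t' by (intro add_mono mult_left_mono abs_le_norm_half) auto
    finally show ?thesis .
  qed
  have \<phi>_le: "\<bar>\<phi> f\<bar> \<le> nrm f" for f
    using \<phi>_halves[of f] cd_le[of f] by linarith
  have \<phi>x: "\<phi> x = 1"
    using cd1 t t' by (simp add: \<phi>_def mult.commute[of "sgn _"] abs_sgn[symmetric])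
  have dual: "\<phi> \<in> dual_space E nrm"
    using \<phi>_le by (auto simp: dual_space_def \<phi>_def algebra_simps intro!: exI[of _ 1])
  have xB: "x \<in> unit_ball E nrm" using xE xN by (simp add: unit_ball_def)
  have le1: "\<bar>\<phi> f\<bar> \<le> 1" if "f \<in> unit_ball E nrm" for f
    using \<phi>_le[of f] that by (simp add: unit_ball_def)
  have "dual_norm E nrm \<phi> = 1"
    unfolding dual_norm_def using xB le1 \<phi>x by (intro cSup_eq_maximum) (force simp: image_iff)+
  then have supporting: "\<phi> \<in> supporting_functionals E nrm x"
    using dual \<phi>x by (simp add: supporting_functionals_def)
  have sup1: "(SUP f\<in>unit_ball E nrm. \<phi> f) = 1"
    using xB le1 \<phi>x by (intro cSup_eq_maximum) (force simp: image_iff)+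
  \<comment> \<open>thin enough for \<open>corner_on_facet\<close> to apply\<close>
  define S where "S = slice E nrm \<phi> (1/8)"
  have "(SUP y\<in>T. nrm (x - y)) = 2" if T: "is_slice E nrm T" "T \<subseteq> S" for T
  proof -
    obtain \<psi> \<beta> where \<psi>: "\<psi> \<in> dual_space E nrm" and \<beta>: "0 < \<beta>" and T_eq: "T = slice E nrm \<psi> \<beta>"
      using T(1) by (auto simp: is_slice_def)
    obtain w p q where w: "w \<in> T" and pq: "(p, q) \<in> corners"
      and wp: "norm (half 1 w) \<le> p" and wq: "norm (half (-1) w) \<le> q"
      using slice_meets_corner[OF \<psi> \<beta>] T_eq by blast
    have "7/8 < \<phi> w" using w T(2) sup1 by (auto simp: S_def slice_def)
    also have "\<phi> w \<le> c * norm (half 1 w) + d * norm (half (-1) w)"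
      using \<phi>_halves[of w] by linarith
    also have "\<dots> \<le> c * p + d * q"
      using wp wq cd0 by (intro add_mono mult_left_mono) auto
    finally have on_facet: "c * p + d * q = 1"
      using corner_on_facet[OF cd pq] by simp
    have wE: "w \<in> E" using w by (simp add: T_eq slice_def unit_ball_def)
    \<comment> \<open>half of the slack of \<open>w\<close> in \<open>T\<close>, as each of the two perturbations may cost \<open>\<delta>\<close>\<close>
    define \<delta> where "\<delta> = (\<psi> w - ((SUP z\<in>unit_ball E nrm. \<psi> z) - \<beta>)) / 2"
    have "0 < \<delta>" using w by (simp add: \<delta>_def T_eq slice_def)
    have far: "\<exists>y\<in>T. 2 - \<epsilon> < nrm (x - y)" if "0 < \<epsilon>" for \<epsilon>
    proof -
      define \<eta> where "\<eta> = \<epsilon> / 4"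
      have "0 < \<eta>" using that by (simp add: \<eta>_def)
      obtain y where y: "y \<in> E" "\<bar>\<psi> y - \<psi> w\<bar> < \<delta>" "half (-1) y = half (-1) w"
        "norm (half 1 y) \<le> p" "norm (half 1 x) + p - \<eta> < norm (half 1 (x - y))"
        using push_away_on_half[OF \<psi> \<open>0 < \<delta>\<close> \<open>0 < \<eta>\<close> wE xE _ wp] by auto
      obtain z where z: "z \<in> E" "\<bar>\<psi> z - \<psi> y\<bar> < \<delta>" "half 1 z = half 1 y"
        "norm (half (-1) z) \<le> q" "norm (half (-1) x) + q - \<eta> < norm (half (-1) (x - z))"
        using push_away_on_half[OF \<psi> \<open>0 < \<delta>\<close> \<open>0 < \<eta>\<close> y(1) xE, of "-1" q] wq y(3) by auto
      have "nrm z \<le> polygon_norm p q"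
        unfolding nrm_def using y(4) z(3,4) by (intro polygon_norm_mono) auto
      then have "z \<in> unit_ball E nrm"
        using z(1) polygon_norm_corner[OF pq] by (simp add: unit_ball_def)
      moreover have "(SUP z\<in>unit_ball E nrm. \<psi> z) - \<beta> < \<psi> z"
        using y(2) z(2) unfolding \<delta>_def by argo
      ultimately have "z \<in> T" by (simp add: T_eq slice_def)
      moreover have "2 - \<epsilon> < nrm (x - z)"
      proof -
        have "2 - (c + d) * \<eta> = c * (norm (half 1 x) + p - \<eta>) + d * (norm (half (-1) x) + q - \<eta>)"
          using cd1 on_facet by (simp add: algebra_simps)
        also have "\<dots> \<le> c * norm (half 1 (x - z)) + d * norm (half (-1) (x - z))"
          using y(5) z(3,5) cd0 by (intro add_mono mult_left_mono) (auto simp: half_diff)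
        also have "\<dots> \<le> nrm (x - z)" by (rule cd_le)
        finally have "2 - (c + d) * \<eta> \<le> nrm (x - z)" .
        moreover have "(c + d) * \<eta> \<le> 2 * \<eta>"
          using cd0 \<open>0 < \<eta>\<close> by (intro mult_right_mono) auto
        ultimately show ?thesis using \<open>0 < \<epsilon>\<close> unfolding \<eta>_def by linarith
      qed
      ultimately show ?thesis by blast
    qed
    have le2: "nrm (x - y) \<le> 2" if "y \<in> T" for y
      using nrm_diff_le_two[OF xB] that by (auto simp: T_eq slice_def)
    then have bdd: "bdd_above ((\<lambda>y. nrm (x - y)) ` T)" by (rule bdd_aboveI2)
    show ?thesis
    proof (rule antisym)
      show "(SUP y\<in>T. nrm (x - y)) \<le> 2" using w le2 by (intro cSUP_least) auto
      show "2 \<le> (SUP y\<in>T. nrm (x - y))"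
      proof (rule field_le_epsilon)
        fix \<epsilon> :: real assume "0 < \<epsilon>"
        then obtain y where "y \<in> T" "2 - \<epsilon> < nrm (x - y)" using far by blast
        then show "2 \<le> (SUP y\<in>T. nrm (x - y)) + \<epsilon>"
          using cSUP_upper[OF _ bdd, of y] by linarith
      qed
    qed
  qed
  moreover have "is_supporting_slice E nrm x S"
    unfolding is_supporting_slice_def S_def using supporting by (intro bexI[of _ \<phi>] exI[of _ "1/8"]) auto
  ultimately show ?thesis
    using assms by (auto simp: relative_daugavet_point_def daugavet_point_relative_to_def)
qed


section \<open>Absence of Daugavet-points\<close>

lemma tent_in_sphere:
  assumes s: "\<bar>s\<bar> = 1"
  shows "tent (s / 2) (1/2) \<in> E" "nrm (tent (s / 2) (1/2)) = 1" "tent (s / 2) (1/2) (s / 2) = 1"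
proof -
  let ?b = "tent (s / 2) (1/2)"
  have zero: "?b t = 0" if "s * t \<le> 0 \<or> 1 \<le> \<bar>t\<bar>" for t
    using that s by (auto simp: tent_eq_0_iff abs_if split: if_splits)
  then show "?b \<in> E" by (simp add: E_def)
  show one: "?b (s / 2) = 1" by (simp add: tent_apply)
  have "half (- s) ?b = 0"
    using s zero by (auto intro!: bcontfun_eqI simp: half_apply)
  moreover have "norm (half s ?b) = 1"
  proof (rule antisym)
    show "norm (half s ?b) \<le> 1"
      by (intro norm_half_le[OF s]) (simp add: tent_bounds abs_of_nonneg)
    show "1 \<le> norm (half s ?b)"
      using abs_le_norm_half[OF s, of "s / 2" ?b] one s by (auto simp: abs_if split: if_splits)
  qed
  ultimately show "nrm ?b = 1"
    using nrm_sides[OF s, of ?b] by (simp add: polygon_norm_def)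
qed

text \<open>
  Functions in the slice given by evaluation at \<open>s / 2\<close> have a large summand on the side \<open>s\<close>,
  hence a small one on the other side, so their pairs of norms are near the corner with all the
  weight on the side \<open>s\<close>.  Of the three facets only one contains that corner, and on it \<open>x\<close> falls
  short by hypothesis.  The other two forms are at most \<open>4/5\<close> at the corner.
\<close>

lemma not_daugavet_point_off_facet:
  assumes s: "\<bar>s\<bar> = 1" and off: "norm (half s x) + norm (half (- s) x) / 2 < 1"
  shows "\<not> daugavet_point E nrm x"
proof
  assume daug: "daugavet_point E nrm x"
  define \<phi> where "\<phi> f = f (s / 2)" for f :: "real \<Rightarrow>\<^sub>C real"
  define T where "T = slice E nrm \<phi> (1/20)"
  have s2: "0 \<le> s * (s / 2)" by simp
  have \<phi>_le: "\<bar>\<phi> f\<bar> \<le> norm (half s f)" for f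
    unfolding \<phi>_def by (rule abs_le_norm_half[OF s s2])
  have dual: "\<phi> \<in> dual_space E nrm"
  proof -
    have "\<bar>\<phi> f\<bar> \<le> 1 * nrm f" for f
      using norm_bounded[of f "s / 2"] norm_le_nrm[of f] by (simp add: \<phi>_def)
    then show ?thesis
      unfolding dual_space_def by (auto simp: \<phi>_def intro!: exI[of _ 1])
  qed
  have "1 \<le> (SUP z\<in>unit_ball E nrm. \<phi> z)"
    using tent_in_sphere[OF s]
    by (intro cSUP_upper2[OF dual_bdd_above[OF dual], where x = "tent (s / 2) (1/2)"])
       (auto simp: unit_ball_def \<phi>_def)
  then have T: "y \<in> E \<and> nrm y \<le> 1 \<and> 19/20 < norm (half s y)" if "y \<in> T" for y
    using that \<phi>_le[of y] by (auto simp: T_def slice_def unit_ball_def)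
  \<comment> \<open>in the slice the other two forms exceed their values at the corner by at most \<open>1/10\<close>, as
      the small summand has norm less than \<open>1/10\<close>; thus they are at most \<open>1 + 9/10\<close> on \<open>x - y\<close>\<close>
  define M where "M = max (1 + (norm (half s x) + norm (half (- s) x) / 2)) (19/10)"
  have xN: "nrm x = 1" using daug by (simp add: daugavet_point_def unit_sphere_def)
  have le: "nrm (x - y) \<le> M" if "y \<in> T" for y
  proof -
    have "nrm (x - y) \<le> polygon_norm (norm (half s x) + norm (half s y))
                              (norm (half (- s) x) + norm (half (- s) y))"
      unfolding nrm_sides[OF s] using s
      by (intro polygon_norm_mono) (auto simp: half_diff norm_triangle_ineq4)
    also have "\<dots> \<le> M"
    proof -
      have "norm (half s x) / 2 + norm (half (- s) x) \<le> 1"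
           "4/5 * norm (half s x) + 4/5 * norm (half (- s) x) \<le> 1"
        using xN unfolding nrm_sides[OF s] polygon_norm_def by auto
      moreover have "19/20 < norm (half s y)" "norm (half s y) + norm (half (- s) y) / 2 \<le> 1"
        using T[OF that] unfolding nrm_sides[OF s] polygon_norm_def by auto
      ultimately show ?thesis
        unfolding polygon_norm_def M_def max.bounded_iff le_max_iff_disj
        by argo
    qed
    finally show ?thesis .
  qed
  obtain y where "y \<in> T"
    using slice_nonempty[OF dual, of "1/20"] by (auto simp: T_def)
  then have "(SUP y\<in>T. nrm (x - y)) \<le> M"
    using le by (intro cSUP_least) auto
  moreover have "is_slice E nrm T"
    unfolding is_slice_def T_def using dual by (intro bexI[of _ \<phi>] exI[of _ "1/20"]) auto
  ultimately have "2 \<le> M"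
    using daug by (auto simp: daugavet_point_def)
  then show False using off by (simp add: M_def)
qed

text \<open>
  If \<open>x\<close> shared a facet with both end corners, its pair of norms would satisfy
  \<open>a + b / 2 \<ge> 1\<close> and \<open>a / 2 + b \<ge> 1\<close>, so \<open>a + b \<ge> 4/3\<close>, beyond the bound \<open>5/4\<close> of the middle facet.
\<close>

lemma no_daugavet_point: "\<not> daugavet_point E nrm x"
proof
  assume daug: "daugavet_point E nrm x"
  then have "nrm x = 1" by (simp add: daugavet_point_def unit_sphere_def)
  moreover have "1 \<le> norm (half 1 x) + norm (half (-1) x) / 2"
    using not_daugavet_point_off_facet[of 1 x] daug by force
  moreover have "1 \<le> norm (half (-1) x) + norm (half 1 x) / 2"
    using not_daugavet_point_off_facet[of "-1" x] daug by force
  ultimately show False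
    unfolding nrm_def polygon_norm_def by linarith
qed

(* The ambient type only supplies a vector space of dimension continuum; every real vector space
   of at most that dimension is linearly isomorphic to a subspace of it.  Its sup norm plays
   no role. *)
theorem corollary3p38:
  shows "\<exists>(X :: (real \<Rightarrow>\<^sub>C real) set) (N :: (real \<Rightarrow>\<^sub>C real) \<Rightarrow> real).
           banach_space_on X N \<and> relative_daugavet_property X N \<and>
           (\<nexists>x. daugavet_point X N x)"
proof (intro exI conjI)
  show "banach_space_on E nrm" by (rule banach_space)
  have "E \<noteq> {0}"
    using tent_in_sphere[of 1] E.zero_iff[of "tent (1/2) (1/2)"] by auto
  then show "relative_daugavet_property E nrm"
    using relative_daugavet_point by (auto simp: relative_daugavet_property_def)
  show "\<nexists>x. daugavet_point E nrm x" using no_daugavet_point by blast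
qed

end
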